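(* Let $X$ be a complex Banach space, let $A\neq 0$ be a bounded linear operator on $X$, let $p>0$, and let $K\in\mathcal S_{p,\infty}^{(e)}(X)$. Let $|\lambda_1|\geq|\lambda_2|\geq\ldots>r_{ess}(A)$ be the discrete eigenvalues of $A+K$ lying outside the closed disk $\{\lambda\in\mathbb C:|\lambda|\leq r_{ess}(A)\}$, each counted as many times as its algebraic multiplicity, with the convention that $\lambda_{m+1}=\lambda_{m+2}=\ldots=r_{ess}(A)$ if there are only $m\in\mathbb N_0$ such eigenvalues. Then $$ \left\|\big((|\lambda_n|-\|A\|)_+\big)_{n\in\mathbb N}\right\|_{p+1,\infty}^{p+1}\leq C_p\, r(A+K)\,\|K\|_{p,\infty}^p, $$ where $C_p:=\dfrac{\ln(2)\,(p+1)^{p+1}}{2p^p}$, $t_+:=\max(t,0)$, and $r(A+K)$ is the spectral radius of $A+K$.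
   Context: The discrete eigenvalues of a bounded operator are its isolated eigenvalues of finite algebraic multiplicity. The essential spectrum $\sigma_{ess}(A)$ is the set of $\lambda\in\mathbb C$ such that $\lambda-A$ is not Fredholm, and $r_{ess}(A)=\max\{|\lambda|:\lambda\in\sigma_{ess}(A)\}$ is the essential spectral radius (with $r_{ess}(A)=0$ if $\sigma_{ess}(A)=\emptyset$). For a null sequence $x=(x_n)_{n\in\mathbb N}$ with decreasing rearrangement $(x_n^* )$ of $(|x_n|)$ and $0<q<\infty$, the weak $l_q$ quasi-norm is $\|x\|_{q,\infty}=\sup_{n\in\mathbb N} n^{1/q}x_n^*$. Entropy numbers: for a bounded linear operator $T$ on $X$ with closed unit ball $B_X$ and $n\in\mathbb N=\{1,2,\dots\}$, $e_n(T)$ is the infimum of all $\varepsilon>0$ for which there exist $q\le 2^{n-1}$ and $y_1,\dots,y_q\in X$ with $T(B_X)\subset\bigcup_{i=1}^q(\{y_i\}+\varepsilon B_X)$. For $p>0$, $\mathcal S_{p,\infty}^{(e)}(X)$ is the set of bounded operators $T$ on $X$ with $\|T\|_{p,\infty}:=\sup_{n\in\mathbb N} n^{1/p}e_n(T)<\infty$ (such operators are compact). *)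

theory Defs
  imports "HOL-Analysis.Analysis"
begin

class complex_normed_vector = real_normed_vector +
  fixes scaleC :: "complex \<Rightarrow> 'a \<Rightarrow> 'a" (infixr "*\<^sub>C" 75)
  assumes scaleC_add_right: "c *\<^sub>C (x + y) = c *\<^sub>C x + c *\<^sub>C y"
    and scaleC_add_left: "(c + d) *\<^sub>C x = c *\<^sub>C x + d *\<^sub>C x"
    and scaleC_scaleC: "c *\<^sub>C d *\<^sub>C x = (c * d) *\<^sub>C x"
    and scaleC_of_real: "complex_of_real r *\<^sub>C x = r *\<^sub>R x"
    and norm_scaleC: "norm (c *\<^sub>C x) = cmod c * norm x"

class complex_banach = complex_normed_vector + banach

instantiation complex :: complex_banach
begin

definition scaleC_complex :: "complex \<Rightarrow> complex \<Rightarrow> complex"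
  where "scaleC_complex c x = c * x"

instance
  by standard (simp_all add: scaleC_complex_def algebra_simps norm_mult scaleR_conv_of_real)

end

global_interpretation complex_vector: vector_space
  "scaleC :: complex \<Rightarrow> 'a \<Rightarrow> 'a::complex_normed_vector"
proof
  fix x :: 'a
  show "1 *\<^sub>C x = x"
    using scaleC_of_real[of 1 x] by simp
qed (simp_all add: scaleC_add_right scaleC_add_left scaleC_scaleC)

text \<open>\<^const>\<open>vector_space.dim\<close> is 0 on infinite-dimensional spaces, so finiteness of a
  dimension is stated separately.\<close>

definition finite_dimensional :: "'a::complex_normed_vector set \<Rightarrow> bool"
  where "finite_dimensional V \<longleftrightarrow> (\<exists>B. finite B \<and> V \<subseteq> complex_vector.span B)"

definition finite_codimensional :: "'a::complex_normed_vector set \<Rightarrow> bool"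
  where "finite_codimensional V \<longleftrightarrow>
    (\<exists>B. finite B \<and> (\<forall>x. \<exists>v\<in>V. \<exists>b\<in>complex_vector.span B. x = v + b))"


section \<open>Bounded operators and their spectra\<close>

definition bounded_clinear ::
    "('a::complex_normed_vector \<Rightarrow> 'b::complex_normed_vector) \<Rightarrow> bool"
  where "bounded_clinear T \<longleftrightarrow> bounded_linear T \<and> (\<forall>c x. T (c *\<^sub>C x) = c *\<^sub>C T x)"

definition shifted_op :: "complex \<Rightarrow> ('a::complex_normed_vector \<Rightarrow> 'a) \<Rightarrow> 'a \<Rightarrow> 'a"
  where "shifted_op l T = (\<lambda>x. l *\<^sub>C x - T x)"

definition boundedly_invertible :: "('a::complex_normed_vector \<Rightarrow> 'a) \<Rightarrow> bool"
  where "boundedly_invertible T \<longleftrightarrow> (\<exists>S. bounded_clinear S \<and> S \<circ> T = id \<and> T \<circ> S = id)"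

definition spectrum :: "('a::complex_normed_vector \<Rightarrow> 'a) \<Rightarrow> complex set"
  where "spectrum T = {l. \<not> boundedly_invertible (shifted_op l T)}"

text \<open>The spectrum of a bounded operator on a nonzero complex Banach space is nonempty and
  compact, so this supremum is a maximum.\<close>

definition spectral_radius :: "('a::complex_normed_vector \<Rightarrow> 'a) \<Rightarrow> real"
  where "spectral_radius T = (SUP l\<in>spectrum T. cmod l)"

definition fredholm :: "('a::complex_normed_vector \<Rightarrow> 'a) \<Rightarrow> bool"
  where "fredholm T \<longleftrightarrow> finite_dimensional {x. T x = 0} \<and>
    closed (range T) \<and> finite_codimensional (range T)"

definition essential_spectrum :: "('a::complex_normed_vector \<Rightarrow> 'a) \<Rightarrow> complex set"
  where "essential_spectrum T = {l. \<not> fredholm (shifted_op l T)}"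

text \<open>The essential spectrum is compact, so in the second case the supremum is a maximum.\<close>

definition essential_spectral_radius :: "('a::complex_normed_vector \<Rightarrow> 'a) \<Rightarrow> real"
  where "essential_spectral_radius T =
    (if essential_spectrum T = {} then 0 else (SUP l\<in>essential_spectrum T. cmod l))"


section \<open>Discrete eigenvalues\<close>

definition eigenvalue :: "('a::complex_normed_vector \<Rightarrow> 'a) \<Rightarrow> complex \<Rightarrow> bool"
  where "eigenvalue T l \<longleftrightarrow> (\<exists>x. x \<noteq> 0 \<and> T x = l *\<^sub>C x)"

definition generalized_eigenspace :: "('a::complex_normed_vector \<Rightarrow> 'a) \<Rightarrow> complex \<Rightarrow> 'a set"
  where "generalized_eigenspace T l = (\<Union>k. {x. (shifted_op l T ^^ k) x = 0})"

text \<open>For an isolated point \<open>l\<close> of the spectrum of \<open>T\<close> with \<open>l - T\<close> Fredholm, the generalized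
  eigenspace is the range of the Riesz projection. By stability of the essential spectrum under
  compact perturbations, this covers the eigenvalues of \<open>A + K\<close>, \<open>K\<close> compact, of modulus larger
  than the essential spectral radius of \<open>A\<close>.\<close>

definition algebraic_multiplicity :: "('a::complex_normed_vector \<Rightarrow> 'a) \<Rightarrow> complex \<Rightarrow> nat"
  where "algebraic_multiplicity T l = complex_vector.dim (generalized_eigenspace T l)"

definition discrete_eigenvalues :: "('a::complex_normed_vector \<Rightarrow> 'a) \<Rightarrow> complex set"
  where "discrete_eigenvalues T =
    {l. eigenvalue T l \<and> l isolated_in spectrum T \<and>
        finite_dimensional (generalized_eigenspace T l)}"

definition discrete_eigenvalues_outside ::
    "('a::complex_normed_vector \<Rightarrow> 'a) \<Rightarrow> real \<Rightarrow> complex set"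
  where "discrete_eigenvalues_outside T \<rho> = {l\<in>discrete_eigenvalues T. \<rho> < cmod l}"

text \<open>Sequences are indexed by \<open>1, 2, \<dots>\<close>; the value at 0 is irrelevant. Since the moduli decrease,
  the indices \<open>n\<close> at which \<open>ev n\<close> is an eigenvalue of modulus larger than \<open>\<rho>\<close> form an initial
  segment. By the last clause its length is the number of these eigenvalues, counted with
  multiplicity; beyond it the sequence is constantly \<open>\<rho>\<close>.\<close>

definition eigenvalue_sequence ::
    "('a::complex_normed_vector \<Rightarrow> 'a) \<Rightarrow> real \<Rightarrow> (nat \<Rightarrow> complex) \<Rightarrow> bool"
  where "eigenvalue_sequence T \<rho> ev \<longleftrightarrow>
    (\<forall>n\<ge>1. ev n \<in> discrete_eigenvalues_outside T \<rho> \<or> ev n = complex_of_real \<rho>) \<and>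
    (\<forall>m\<ge>1. \<forall>n\<ge>m. cmod (ev n) \<le> cmod (ev m)) \<and>
    (\<forall>l\<in>discrete_eigenvalues_outside T \<rho>. card {n. 1 \<le> n \<and> ev n = l} = algebraic_multiplicity T l)"


section \<open>Weak quasi-norms and entropy numbers\<close>

text \<open>Quasi-norms take values in \<^typ>\<open>ennreal\<close>, so that an infinite supremum is not replaced by a
  junk value.\<close>

definition ennreal_powr :: "ennreal \<Rightarrow> real \<Rightarrow> ennreal" (infixr "powr\<^sub>e" 80)
  where "x powr\<^sub>e a = (if x = top then top else ennreal (enn2real x powr a))"

text \<open>The \<open>n\<close>-th term, \<open>n \<ge> 1\<close>, of the decreasing rearrangement of \<open>\<bar>x 1\<bar>, \<bar>x 2\<bar>, \<dots>\<close>.\<close>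

definition decreasing_rearrangement :: "(nat \<Rightarrow> real) \<Rightarrow> nat \<Rightarrow> ennreal"
  where "decreasing_rearrangement x n =
    (INF s\<in>{s. 0 \<le> s \<and> finite {k. 1 \<le> k \<and> s < \<bar>x k\<bar>} \<and> card {k. 1 \<le> k \<and> s < \<bar>x k\<bar>} < n}.
      ennreal s)"

definition weak_lq_norm :: "real \<Rightarrow> (nat \<Rightarrow> real) \<Rightarrow> ennreal"
  where "weak_lq_norm q x =
    (SUP n\<in>{1..}. ennreal (real n powr (1 / q)) * decreasing_rearrangement x n)"

text \<open>The translate \<open>{y} + \<epsilon> B\<close> of the scaled closed unit ball is \<^term>\<open>cball y \<epsilon>\<close>.\<close>

definition entropy_number :: "nat \<Rightarrow> ('a::complex_normed_vector \<Rightarrow> 'a) \<Rightarrow> real"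
  where "entropy_number n T =
    Inf {\<epsilon>. 0 < \<epsilon> \<and> (\<exists>Y. finite Y \<and> card Y \<le> 2 ^ (n - 1) \<and> T ` cball 0 1 \<subseteq> (\<Union>y\<in>Y. cball y \<epsilon>))}"

definition entropy_quasinorm :: "real \<Rightarrow> ('a::complex_normed_vector \<Rightarrow> 'a) \<Rightarrow> ennreal"
  where "entropy_quasinorm p T =
    (SUP n\<in>{1..}. ennreal (real n powr (1 / p) * entropy_number n T))"

definition entropy_class :: "real \<Rightarrow> ('a::complex_normed_vector \<Rightarrow> 'a) set"
  where "entropy_class p = {T. bounded_clinear T \<and> entropy_quasinorm p T < top}"

definition entropy_const :: "real \<Rightarrow> real"
  where "entropy_const p = ln 2 * (p + 1) powr (p + 1) / (2 * p powr p)"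

end

theory Submission
  imports Defs
begin

text \<open>
  Put \<open>T = A + K\<close> and let \<open>\<lambda>\<^sub>1, \<dots>, \<lambda>\<^sub>n\<close> be the leading eigenvalues, with \<open>\<bar>\<lambda>\<^sub>n\<bar> > \<parallel>A\<parallel>\<close>. The core is
  an inequality of Carl and Triebel type: if \<open>T\<close> maps the unit ball \<open>B\<close> into \<open>N\<close> balls of radius
  \<open>\<epsilon>\<close>, then \<open>\<bar>\<lambda>\<^sub>n\<bar> ^ (2 n) \<le> N \<epsilon> ^ (2 n)\<close> (\<open>power_le_of_covered_by\<close>). A volume comparison on an invariant
  subspace of complex dimension \<open>n\<close> gives it up to constants, and the constants disappear on passing
  to powers: \<open>T\<^sup>k\<close> maps \<open>B\<close> into \<open>N\<^sup>k\<close> balls of radius \<open>\<epsilon>\<^sup>k\<close>, and one takes \<open>k\<close>-th roots. Since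
  only the exponential rate in \<open>k\<close> matters, volumes can be replaced by counting: \<open>T\<close> is triangular
  with diagonal \<open>\<lambda>\<^sub>1, \<dots>, \<lambda>\<^sub>n\<close> on a suitable flag of subspaces (\<open>triangular_flag_exists\<close>), and a grid in
  the coordinates of that flag has, if \<open>\<bar>\<lambda>\<^sub>n\<bar> > \<epsilon>\<close>, of the order of \<open>(\<bar>\<lambda>\<^sub>n\<bar> / \<epsilon>) ^ (2 n k)\<close> points in \<open>B\<close> whose images under \<open>T\<^sup>k\<close>
  are separated by \<open>3 \<epsilon>\<^sup>k\<close> (\<open>separated_grid\<close>). No two of these images lie in the same ball.

  A covering of \<open>K B\<close> by balls of radius \<open>\<epsilon>\<close> becomes a covering of \<open>T B\<close> by as many balls of radius
  \<open>\<parallel>A\<parallel> + \<epsilon>\<close>. So \<open>\<bar>\<lambda>\<^sub>n\<bar> \<le> 2 powr ((m - 1) / (2 n)) * (\<parallel>A\<parallel> + e\<^sub>m(K))\<close> for all \<open>m \<ge> 1\<close>. With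
  \<open>2 powr (- x) \<ge> 1 - x ln 2\<close>, \<open>\<bar>\<lambda>\<^sub>n\<bar> \<le> r(T)\<close> and \<open>m = \<lceil>s\<rceil>\<close> for real \<open>s > 0\<close> this yields
  \<open>\<bar>\<lambda>\<^sub>n\<bar> - \<parallel>A\<parallel> \<le> r(T) ln 2 / (2 n) * s + \<parallel>K\<parallel>\<^sub>p s powr (- (1 / p))\<close>,
  where \<open>\<parallel>K\<parallel>\<^sub>p\<close> is the entropy quasi-norm of \<open>K\<close>.
  Minimising over \<open>s\<close> produces the constant of the theorem (\<open>optimise_sum_of_powers\<close>). Eigenvalues of
  modulus at most \<open>\<parallel>A\<parallel>\<close>, and the padding of the sequence by the essential spectral radius of \<open>A\<close>,
  contribute nothing, because that radius is at most \<open>\<parallel>A\<parallel>\<close>.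
\<close>

section \<open>Complex-linear maps and invariant subspaces\<close>

abbreviation clinear :: "('a::complex_normed_vector \<Rightarrow> 'a) \<Rightarrow> bool"
  where "clinear \<equiv> Vector_Spaces.linear scaleC scaleC"

lemma bounded_clinear_imp_clinear:
  assumes "bounded_clinear T"
  shows "clinear T"
  using assms unfolding bounded_clinear_def Vector_Spaces.linear_iff
  by (auto simp: complex_vector.vector_space_axioms bounded_linear.linear linear_add)

lemma clinear_funpow:
  assumes "clinear T"
  shows "clinear (T ^^ k)"
proof (induction k)
  case 0
  show ?case
    using complex_vector.vector_space_axioms by (simp add: Vector_Spaces.linear_iff)
next
  case (Suc k)
  then show ?case
    using assms by (simp add: Vector_Spaces.linear_iff)
qed

lemma clinear_shifted_op:
  assumes "clinear T"
  shows "clinear (shifted_op l T)"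
proof -
  interpret T: Vector_Spaces.linear scaleC scaleC T by fact
  show ?thesis
    unfolding Vector_Spaces.linear_iff shifted_op_def
    using complex_vector.vector_space_axioms
    by (auto simp: T.add T.scale scaleC_add_right complex_vector.scale_right_diff_distrib
        scaleC_scaleC mult.commute)
qed

lemma clinear_diff: "clinear T \<Longrightarrow> T (x - y) = T x - T y"
  by (rule module_hom.diff) (rule module_hom_iff_linear[THEN iffD2])

lemma funpow_in_invariant_set:
  assumes "\<And>f. f \<in> F \<Longrightarrow> T f \<in> F" and "f \<in> F"
  shows "(T ^^ k) f \<in> F"
  using assms by (induction k) auto

lemma clinear_funpow_modulo_subspace:
  assumes T: "clinear T" and F: "complex_vector.subspace F"
    and inv: "\<And>f. f \<in> F \<Longrightarrow> T f \<in> F" and e: "T e - l *\<^sub>C e \<in> F"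
  shows "(T ^^ k) e - l ^ k *\<^sub>C e \<in> F"
proof (induction k)
  case 0
  then show ?case by (simp add: complex_vector.subspace_0[OF F])
next
  case (Suc k)
  interpret T: Vector_Spaces.linear scaleC scaleC T by fact
  have "(T ^^ Suc k) e - l ^ Suc k *\<^sub>C e
      = T ((T ^^ k) e - l ^ k *\<^sub>C e) + l ^ k *\<^sub>C (T e - l *\<^sub>C e)"
    by (simp add: T.diff T.scale complex_vector.scale_right_diff_distrib scaleC_scaleC mult.commute)
  also have "\<dots> \<in> F"
    by (intro complex_vector.subspace_add[OF F] complex_vector.subspace_scale[OF F] inv e Suc)
  finally show ?case .
qed

lemma subspace_generalized_eigenspace:
  fixes T :: "'a::complex_normed_vector \<Rightarrow> 'a"
  assumes T: "clinear T"
  shows "complex_vector.subspace (generalized_eigenspace T l)"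
proof (rule complex_vector.subspaceI)
  have S: "clinear (shifted_op l T ^^ k)" for k
    by (intro clinear_funpow clinear_shifted_op T)
  have mono: "(shifted_op l T ^^ m) x = 0" if "(shifted_op l T ^^ k) x = 0" "k \<le> m" for x k m
  proof -
    have "(shifted_op l T ^^ m) x = (shifted_op l T ^^ (m - k)) ((shifted_op l T ^^ k) x)"
      using that(2) by (metis funpow_add comp_apply le_add_diff_inverse2)
    also have "\<dots> = 0"
      using that(1) clinear_diff[OF S[of "m - k"], of 0 0] by simp
    finally show ?thesis .
  qed
  show "0 \<in> generalized_eigenspace T l"
    unfolding generalized_eigenspace_def by (auto intro: exI[of _ 0])
  show "x + y \<in> generalized_eigenspace T l"
    if xy: "x \<in> generalized_eigenspace T l" "y \<in> generalized_eigenspace T l" for x y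
  proof -
    obtain i j where "(shifted_op l T ^^ i) x = 0" "(shifted_op l T ^^ j) y = 0"
      using xy by (auto simp: generalized_eigenspace_def)
    then have "(shifted_op l T ^^ max i j) x = 0" "(shifted_op l T ^^ max i j) y = 0"
      by (auto intro: mono)
    then have "(shifted_op l T ^^ max i j) (x + y) = 0"
      using S[of "max i j"] by (simp add: Vector_Spaces.linear_iff)
    then show ?thesis by (auto simp: generalized_eigenspace_def)
  qed
  show "c *\<^sub>C x \<in> generalized_eigenspace T l"
    if "x \<in> generalized_eigenspace T l" for c x
    using that S by (auto simp: generalized_eigenspace_def Vector_Spaces.linear_iff)
qed

text \<open>The constant \<open>d\<close> is a lower bound for the distance from \<open>x\<close> to \<open>F\<close>; the factor \<open>c\<close> enters by
  homogeneity.\<close>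

lemma closed_subspace_separates:
  fixes F :: "'a::complex_normed_vector set"
  assumes F: "complex_vector.subspace F" "closed F" and x: "x \<notin> F"
  obtains d where "d > 0" "\<And>c f. f \<in> F \<Longrightarrow> d * cmod c \<le> norm (c *\<^sub>C x + f)"
proof -
  have "open (- F)" "x \<in> - F" using F x by auto
  then obtain d where d: "d > 0" "ball x d \<subseteq> - F" by (meson open_contains_ball)
  have "d * cmod c \<le> norm (c *\<^sub>C x + f)" if "f \<in> F" for c f
  proof (cases "c = 0")
    case False
    let ?f = "- ((1 / c) *\<^sub>C f)"
    have "?f \<in> F"
      by (intro complex_vector.subspace_neg complex_vector.subspace_scale F(1) that)
    then have "?f \<notin> ball x d" using d(2) by auto
    then have "d \<le> norm (x - ?f)" by (simp add: dist_norm)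
    then have "d * cmod c \<le> cmod c * norm (x - ?f)"
      by (subst mult.commute) (rule mult_left_mono, simp_all)
    also have "\<dots> = norm (c *\<^sub>C (x - ?f))" by (simp add: norm_scaleC)
    also have "c *\<^sub>C (x - ?f) = c *\<^sub>C x + f"
      using False by (simp add: scaleC_add_right scaleC_scaleC)
    finally show ?thesis .
  qed simp
  then show thesis using that d(1) by blast
qed

text \<open>By induction on the spanning set: if \<open>x\<close> has positive distance from the closed subspace \<open>F\<close>, then
  the coefficients of \<open>x\<close> along a convergent sequence in \<open>\<complex>x + F\<close> form a Cauchy sequence.\<close>

lemma closed_cspan_finite:
  fixes B :: "'a::complex_banach set"
  assumes "finite B"
  shows "closed (complex_vector.span B)"
  using assms
proof induction
  case empty
  then show ?case by simp
next
  case (insert x B)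
  let ?F = "complex_vector.span B"
  show ?case
  proof (cases "x \<in> ?F")
    case True
    then show ?thesis using insert.IH by (simp add: complex_vector.span_redundant)
  next
    case False
    obtain d where d: "d > 0" "\<And>c f. f \<in> ?F \<Longrightarrow> d * cmod c \<le> norm (c *\<^sub>C x + f)"
      using closed_subspace_separates[OF complex_vector.subspace_span insert.IH False] by blast
    show ?thesis
      unfolding closed_sequential_limits
    proof (intro allI impI, elim conjE)
      fix y z assume y: "\<forall>n. y n \<in> complex_vector.span (insert x B)" "y \<longlonglongrightarrow> z"
      then have "\<forall>n. \<exists>c. y n - c *\<^sub>C x \<in> ?F" by (simp add: complex_vector.span_insert)
      then obtain c where c: "\<And>n. y n - c n *\<^sub>C x \<in> ?F" by metis
      have bound: "d * cmod (c m - c n) \<le> norm (y m - y n)" for m n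
      proof -
        have "(y m - c m *\<^sub>C x) - (y n - c n *\<^sub>C x) \<in> ?F"
          by (intro complex_vector.span_diff c)
        from d(2)[OF this, of "c m - c n"] show ?thesis
          by (simp add: complex_vector.scale_left_diff_distrib algebra_simps)
      qed
      have "Cauchy c"
      proof (rule metric_CauchyI)
        fix r :: real assume "r > 0"
        then have "d * r > 0" using d(1) by simp
        from metric_CauchyD[OF LIMSEQ_imp_Cauchy[OF y(2)] this]
        obtain N where "\<And>m n. m \<ge> N \<Longrightarrow> n \<ge> N \<Longrightarrow> norm (y m - y n) < d * r"
          by (auto simp: dist_norm)
        then have "d * cmod (c m - c n) < d * r" if "m \<ge> N" "n \<ge> N" for m n
          using bound[of m n] that by (meson le_less_trans)
        then show "\<exists>N. \<forall>m\<ge>N. \<forall>n\<ge>N. dist (c m) (c n) < r"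
          using d(1) by (auto simp: dist_norm)
      qed
      then obtain c0 where c0: "c \<longlonglongrightarrow> c0" by (auto simp: Cauchy_convergent_iff convergent_def)
      have "(\<lambda>n. (c n - c0) *\<^sub>C x) \<longlonglongrightarrow> 0"
      proof (rule tendsto_norm_zero_cancel)
        have "(\<lambda>n. cmod (c n - c0) * norm x) \<longlonglongrightarrow> 0 * norm x"
          using c0 by (intro tendsto_mult_right) (simp add: LIM_zero tendsto_norm_zero)
        then show "(\<lambda>n. norm ((c n - c0) *\<^sub>C x)) \<longlonglongrightarrow> 0" by (simp add: norm_scaleC)
      qed
      from tendsto_diff[OF tendsto_diff[OF y(2) this] tendsto_const[of "c0 *\<^sub>C x"]]
      have "(\<lambda>n. y n - c n *\<^sub>C x) \<longlonglongrightarrow> z - c0 *\<^sub>C x"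
        by (simp add: complex_vector.scale_left_diff_distrib)
      then have "z - c0 *\<^sub>C x \<in> ?F"
        using insert.IH c by (meson closed_sequentially)
      then show "z \<in> complex_vector.span (insert x B)"
        by (auto simp: complex_vector.span_insert)
    qed
  qed
qed

section \<open>Triangularisation on spans of generalized eigenvectors\<close>

text \<open>The second condition says that \<open>e j\<close> has distance at least 1 from the span of its predecessors.
  Beyond linear independence this normalisation makes each coordinate of a vector controllable by the
  norm, once the coordinates of higher index are known.\<close>

definition triangular_flag ::
    "('a::complex_normed_vector \<Rightarrow> 'a) \<Rightarrow> (nat \<Rightarrow> complex) \<Rightarrow> nat \<Rightarrow> (nat \<Rightarrow> 'a) \<Rightarrow> bool"
  where "triangular_flag T l n e \<longleftrightarrow>
    (\<forall>j<n. T (e j) - l j *\<^sub>C e j \<in> complex_vector.span (e ` {..<j}) \<and>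
      (\<forall>c. \<forall>f\<in>complex_vector.span (e ` {..<j}). cmod c \<le> norm (c *\<^sub>C e j + f)))"

lemma triangular_flag_Suc:
  "triangular_flag T l (Suc n) e \<longleftrightarrow> triangular_flag T l n e \<and>
    T (e n) - l n *\<^sub>C e n \<in> complex_vector.span (e ` {..<n}) \<and>
    (\<forall>c. \<forall>f\<in>complex_vector.span (e ` {..<n}). cmod c \<le> norm (c *\<^sub>C e n + f))"
  unfolding triangular_flag_def by (auto simp: less_Suc_eq)

lemma triangular_flag_notin_span:
  assumes "triangular_flag T l (Suc n) e"
  shows "e n \<notin> complex_vector.span (e ` {..<n})"
proof
  assume "e n \<in> complex_vector.span (e ` {..<n})"
  then have "- e n \<in> complex_vector.span (e ` {..<n})"
    by (rule complex_vector.span_neg)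
  then have "cmod 1 \<le> norm (1 *\<^sub>C e n + - e n)"
    using assms unfolding triangular_flag_Suc by blast
  then show False by simp
qed

lemma triangular_flag_invariant:
  assumes T: "clinear T" and "triangular_flag T l n e"
    and "f \<in> complex_vector.span (e ` {..<n})"
  shows "T f \<in> complex_vector.span (e ` {..<n})"
  using assms(2,3)
proof (induction n arbitrary: f)
  case 0
  interpret T: Vector_Spaces.linear scaleC scaleC T by fact
  show ?case using 0 by simp
next
  case (Suc n)
  interpret T: Vector_Spaces.linear scaleC scaleC T by fact
  let ?F = "complex_vector.span (e ` {..<n})" and ?F' = "complex_vector.span (e ` {..<Suc n})"
  have sub: "?F \<subseteq> ?F'" by (intro complex_vector.span_mono) auto
  have e: "e n \<in> ?F'" by (intro complex_vector.span_base) auto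
  obtain c where c: "f - c *\<^sub>C e n \<in> ?F"
    using Suc.prems(2) by (auto simp: lessThan_Suc complex_vector.span_insert)
  have *: "triangular_flag T l n e" "T (e n) - l n *\<^sub>C e n \<in> ?F"
    using Suc.prems(1) by (auto simp: triangular_flag_Suc)
  have "T f = T (f - c *\<^sub>C e n) + c *\<^sub>C ((T (e n) - l n *\<^sub>C e n) + l n *\<^sub>C e n)"
    by (simp add: T.diff T.scale)
  also have "\<dots> \<in> ?F'"
    using Suc.IH[OF *(1) c] *(2) sub e
    by (intro complex_vector.span_add complex_vector.span_scale) auto
  finally show ?case .
qed

text \<open>The diagonal determines how much of a generalized eigenspace fits into the flag. Modulo the span of
  its predecessors, \<open>e n\<close> is an eigenvector of \<open>(\<mu> - T) ^^ k\<close> for the eigenvalue \<open>(\<mu> - l n) ^ k\<close>.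
  If \<open>l n \<noteq> \<mu>\<close>, this is not 0, and adjoining \<open>e n\<close> adds nothing to the intersection; otherwise the
  dimension of the intersection grows by at most 1. The bound is phrased with a spanning set
  because \<^const>\<open>vector_space.dim\<close> is 0 on infinite-dimensional spaces.\<close>

lemma generalized_eigenspace_in_flag:
  assumes T: "clinear T" and flag: "triangular_flag T l n e"
  shows "\<exists>B. finite B \<and> card B \<le> card {j. j < n \<and> l j = \<mu>} \<and>
    generalized_eigenspace T \<mu> \<inter> complex_vector.span (e ` {..<n}) \<subseteq> complex_vector.span B"
  using flag
proof (induction n)
  case 0
  then show ?case by (intro exI[of _ "{}"]) auto
next
  case (Suc n)
  let ?G = "generalized_eigenspace T \<mu>"
  let ?F = "complex_vector.span (e ` {..<n})" and ?F' = "complex_vector.span (e ` {..<Suc n})"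
  have flag: "triangular_flag T l n e" and tri: "T (e n) - l n *\<^sub>C e n \<in> ?F"
    using Suc.prems by (auto simp: triangular_flag_Suc)
  obtain B where B: "finite B" "card B \<le> card {j. j < n \<and> l j = \<mu>}"
      "?G \<inter> ?F \<subseteq> complex_vector.span B"
    using Suc.IH[OF flag] by auto
  note subF = complex_vector.subspace_span[of "e ` {..<n}"]
  show ?case
  proof (cases "l n = \<mu>")
    case False
    have "x \<in> ?F" if x: "x \<in> ?G" "x \<in> ?F'" for x
    proof -
      let ?S = "shifted_op \<mu> T"
      interpret S: Vector_Spaces.linear scaleC scaleC ?S
        using clinear_shifted_op[OF T] .
      obtain k where k: "(?S ^^ k) x = 0"
        using x(1) by (auto simp: generalized_eigenspace_def)
      interpret Sk: Vector_Spaces.linear scaleC scaleC "?S ^^ k"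
        using clinear_funpow[OF clinear_shifted_op[OF T]] .
      obtain c where c: "x - c *\<^sub>C e n \<in> ?F"
        using x(2) by (auto simp: lessThan_Suc complex_vector.span_insert)
      have inv: "?S f \<in> ?F" if "f \<in> ?F" for f
        unfolding shifted_op_def using that triangular_flag_invariant[OF T flag that]
        by (intro complex_vector.span_diff complex_vector.span_scale)
      have "?S (e n) - (\<mu> - l n) *\<^sub>C e n = - (T (e n) - l n *\<^sub>C e n)"
        by (simp add: shifted_op_def complex_vector.scale_left_diff_distrib)
      then have "?S (e n) - (\<mu> - l n) *\<^sub>C e n \<in> ?F"
        using complex_vector.span_neg[OF tri] by simp
      from clinear_funpow_modulo_subspace[OF clinear_shifted_op[OF T] subF inv this]
      have "(?S ^^ k) (e n) - (\<mu> - l n) ^ k *\<^sub>C e n \<in> ?F" by blast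
      then have "c *\<^sub>C ((?S ^^ k) (e n) - (\<mu> - l n) ^ k *\<^sub>C e n) + (?S ^^ k) (x - c *\<^sub>C e n) \<in> ?F"
        using funpow_in_invariant_set[OF inv c]
        by (intro complex_vector.span_add complex_vector.span_scale) auto
      also have "c *\<^sub>C ((?S ^^ k) (e n) - (\<mu> - l n) ^ k *\<^sub>C e n) + (?S ^^ k) (x - c *\<^sub>C e n)
          = - ((c * (\<mu> - l n) ^ k) *\<^sub>C e n)"
        by (simp add: Sk.diff Sk.scale k complex_vector.scale_right_diff_distrib scaleC_scaleC)
      finally have "(c * (\<mu> - l n) ^ k) *\<^sub>C e n \<in> ?F"
        using complex_vector.span_neg by fastforce
      have "c * (\<mu> - l n) ^ k = 0"
      proof (rule ccontr)
        let ?a = "c * (\<mu> - l n) ^ k"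
        assume "?a \<noteq> 0"
        then have "1 / ?a * ?a = 1" by (rule nonzero_eq_divide_eq[THEN iffD1, OF _ refl])
        then have "e n = (1 / ?a) *\<^sub>C (?a *\<^sub>C e n)"
          by (simp only: scaleC_scaleC complex_vector.scale_one)
        also have "\<dots> \<in> ?F" by (rule complex_vector.span_scale) fact
        finally show False using triangular_flag_notin_span[OF Suc.prems] by blast
      qed
      then have "c = 0" using False by auto
      then show ?thesis using c by simp
    qed
    moreover have "{j. j < Suc n \<and> l j = \<mu>} = {j. j < n \<and> l j = \<mu>}"
      using False by (auto simp: less_Suc_eq)
    ultimately show ?thesis
      using B by (intro exI[of _ B]) auto
  next
    case True
    have eq: "{j. j < Suc n \<and> l j = \<mu>} = insert n {j. j < n \<and> l j = \<mu>}"
      using True by (auto simp: less_Suc_eq)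
    have card: "card {j. j < Suc n \<and> l j = \<mu>} = Suc (card {j. j < n \<and> l j = \<mu>})"
      unfolding eq by (subst card_insert_disjoint) auto
    show ?thesis
    proof (cases "?G \<inter> ?F' \<subseteq> ?F")
      case True
      then show ?thesis using B card by (intro exI[of _ B]) auto
    next
      case False
      then obtain x where x: "x \<in> ?G" "x \<in> ?F'" "x \<notin> ?F" by auto
      obtain a where a: "x - a *\<^sub>C e n \<in> ?F"
        using x(2) by (auto simp: lessThan_Suc complex_vector.span_insert)
      have "a \<noteq> 0" using a x(3) by auto
      have "y \<in> complex_vector.span (insert x B)" if y: "y \<in> ?G" "y \<in> ?F'" for y
      proof -
        obtain b where b: "y - b *\<^sub>C e n \<in> ?F"
          using y(2) by (auto simp: lessThan_Suc complex_vector.span_insert)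
        have "(y - b *\<^sub>C e n) - (b / a) *\<^sub>C (x - a *\<^sub>C e n) \<in> ?F"
          by (rule complex_vector.span_diff[OF b complex_vector.span_scale[OF a]])
        also have "(y - b *\<^sub>C e n) - (b / a) *\<^sub>C (x - a *\<^sub>C e n) = y - (b / a) *\<^sub>C x"
          using \<open>a \<noteq> 0\<close> by (simp add: complex_vector.scale_right_diff_distrib scaleC_scaleC)
        finally have "y - (b / a) *\<^sub>C x \<in> ?F" .
        moreover have "y - (b / a) *\<^sub>C x \<in> ?G"
          using subspace_generalized_eigenspace[OF T] x y
          by (intro complex_vector.subspace_diff complex_vector.subspace_scale)
        ultimately show ?thesis
          using B(3) by (auto simp: complex_vector.span_insert)
      qed
      moreover have "card (insert x B) \<le> Suc (card B)"
        using B(1) by (simp add: card_insert_if)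
      ultimately show ?thesis
        using B card by (intro exI[of _ "insert x B"]) auto
    qed
  qed
qed

text \<open>By the previous count the generalized eigenspace of \<open>l n\<close> is not contained in the span \<open>F\<close> of the flag. A
  vector \<open>x\<close> of it outside \<open>F\<close> is moved into \<open>F\<close> by some power of \<open>l n - T\<close>; the last iterate
  outside \<open>F\<close>, scaled to have distance at least 1 from \<open>F\<close>, is the new member of the flag.\<close>

lemma triangular_flag_extend:
  fixes T :: "'a::complex_banach \<Rightarrow> 'a"
  assumes T: "clinear T" and flag: "triangular_flag T l n e"
    and mult: "card {j. j < n \<and> l j = l n} < algebraic_multiplicity T (l n)"
  obtains e' where "triangular_flag T l (Suc n) e'"
proof -
  let ?F = "complex_vector.span (e ` {..<n})"
  let ?G = "generalized_eigenspace T (l n)"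
  let ?S = "shifted_op (l n) T"
  obtain B where B: "finite B" "card B \<le> card {j. j < n \<and> l j = l n}"
      "?G \<inter> ?F \<subseteq> complex_vector.span B"
    using generalized_eigenspace_in_flag[OF T flag, of "l n"] by blast
  have "\<not> ?G \<subseteq> ?F"
  proof
    assume "?G \<subseteq> ?F"
    then have "?G \<subseteq> complex_vector.span B" using B(3) by blast
    then have "algebraic_multiplicity T (l n) \<le> card B"
      unfolding algebraic_multiplicity_def using B(1) by (rule complex_vector.dim_le_card)
    then show False using B(2) mult by simp
  qed
  then obtain x where x: "x \<in> ?G" "x \<notin> ?F" by blast
  define k where "k = (LEAST k. (?S ^^ k) x \<in> ?F)"
  obtain k' where "(?S ^^ k') x = 0"
    using x(1) by (auto simp: generalized_eigenspace_def)
  then have "(?S ^^ k') x \<in> ?F" by (simp add: complex_vector.span_zero)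
  then have k: "(?S ^^ k) x \<in> ?F" unfolding k_def by (rule LeastI)
  then obtain m where m: "k = Suc m" using x(2) by (cases k) auto
  define z where "z = (?S ^^ m) x"
  have z: "z \<notin> ?F"
    using not_less_Least[of m "\<lambda>k. (?S ^^ k) x \<in> ?F"] m by (auto simp: k_def z_def)
  have Sz: "?S z \<in> ?F" using k by (simp add: m z_def)
  have "closed ?F" by (intro closed_cspan_finite) auto
  then obtain d where d: "d > 0" "\<And>c f. f \<in> ?F \<Longrightarrow> d * cmod c \<le> norm (c *\<^sub>C z + f)"
    using closed_subspace_separates[OF complex_vector.subspace_span _ z] by blast
  define w where "w = complex_of_real (1 / d) *\<^sub>C z"
  define e' where "e' = e(n := w)"
  have e': "e' ` {..<j} = e ` {..<j}" if "j \<le> n" for j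
    using that unfolding e'_def by (intro image_cong) auto
  have "T w - l n *\<^sub>C w = complex_of_real (- 1 / d) *\<^sub>C ?S z"
    using T unfolding w_def shifted_op_def
    by (simp add: Vector_Spaces.linear_iff complex_vector.scale_right_diff_distrib scaleC_scaleC mult.commute)
  then have "T w - l n *\<^sub>C w \<in> ?F"
    using complex_vector.span_scale[OF Sz] by (simp only:)
  moreover have "cmod c \<le> norm (c *\<^sub>C w + f)" if "f \<in> ?F" for c f
    using d(2)[OF that, of "c * complex_of_real (1 / d)"] d(1)
    by (simp add: w_def scaleC_scaleC norm_mult norm_divide)
  moreover have "e' n = w" by (simp add: e'_def)
  moreover have "triangular_flag T l n e'"
    unfolding triangular_flag_def
  proof (intro allI impI)
    fix j assume "j < n"
    then have "e' j = e j" by (simp add: e'_def)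
    moreover have "e' ` {..<j} = e ` {..<j}" using \<open>j < n\<close> by (intro e') simp
    ultimately show "T (e' j) - l j *\<^sub>C e' j \<in> complex_vector.span (e' ` {..<j}) \<and>
        (\<forall>c. \<forall>f\<in>complex_vector.span (e' ` {..<j}). cmod c \<le> norm (c *\<^sub>C e' j + f))"
      using flag \<open>j < n\<close> unfolding triangular_flag_def by simp
  qed
  ultimately have "triangular_flag T l (Suc n) e'"
    unfolding triangular_flag_Suc by (simp only: e' order_refl) blast
  then show thesis by (rule that)
qed

lemma triangular_flag_exists:
  fixes T :: "'a::complex_banach \<Rightarrow> 'a"
  assumes T: "clinear T"
    and mult: "\<And>i. i < n \<Longrightarrow> card {j. j < n \<and> l j = l i} \<le> algebraic_multiplicity T (l i)"
  obtains e where "triangular_flag T l n e"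
proof -
  have "\<exists>e. triangular_flag T l m e" if "m \<le> n" for m
    using that
  proof (induction m)
    case 0
    then show ?case by (simp add: triangular_flag_def)
  next
    case (Suc m)
    then obtain e where e: "triangular_flag T l m e" by auto
    have "{j. j < m \<and> l j = l m} \<subset> {j. j < n \<and> l j = l m}"
    proof
      show "{j. j < m \<and> l j = l m} \<subseteq> {j. j < n \<and> l j = l m}" using Suc.prems by auto
      have "m \<in> {j. j < n \<and> l j = l m}" "m \<notin> {j. j < m \<and> l j = l m}" using Suc.prems by auto
      then show "{j. j < m \<and> l j = l m} \<noteq> {j. j < n \<and> l j = l m}" by blast
    qed
    then have "card {j. j < m \<and> l j = l m} < card {j. j < n \<and> l j = l m}"
      by (intro psubset_card_mono) auto
    also have "\<dots> \<le> algebraic_multiplicity T (l m)"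
      using mult Suc.prems by simp
    finally show ?case
      by (rule triangular_flag_extend[OF T e]) blast
  qed
  then show thesis using that by blast
qed

section \<open>Coverings, separated sets and the eigenvalue inequality\<close>

definition covered_by :: "'a::metric_space set \<Rightarrow> nat \<Rightarrow> real \<Rightarrow> bool"
  where "covered_by S N \<epsilon> \<longleftrightarrow> (\<exists>Y. finite Y \<and> card Y \<le> N \<and> S \<subseteq> (\<Union>y\<in>Y. cball y \<epsilon>))"

text \<open>Each ball of a covering of the image under \<open>T ^^ k\<close> is a translate of \<open>\<epsilon> ^ k\<close> times the unit ball,
  so \<open>T\<close> maps it into \<open>N\<close> balls of radius \<open>\<epsilon> ^ Suc k\<close>.\<close>

lemma covered_by_funpow:
  fixes T :: "'a::complex_normed_vector \<Rightarrow> 'a"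
  assumes T: "clinear T" and cov: "covered_by (T ` cball 0 1) N \<epsilon>" and "\<epsilon> > 0"
  shows "covered_by ((T ^^ k) ` cball 0 1) (N ^ k) (\<epsilon> ^ k)"
proof (induction k)
  case 0
  show ?case unfolding covered_by_def by (intro exI[of _ "{0}"]) auto
next
  case (Suc k)
  interpret T: Vector_Spaces.linear scaleC scaleC T by fact
  obtain Y where Y: "finite Y" "card Y \<le> N" "T ` cball 0 1 \<subseteq> (\<Union>y\<in>Y. cball y \<epsilon>)"
    using cov unfolding covered_by_def by blast
  obtain Z where Z: "finite Z" "card Z \<le> N ^ k"
      "(T ^^ k) ` cball 0 1 \<subseteq> (\<Union>z\<in>Z. cball z (\<epsilon> ^ k))"
    using Suc.IH unfolding covered_by_def by blast
  define h where "h = (\<lambda>(y, z). T z + (\<epsilon> ^ k) *\<^sub>R y)"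
  have T_R: "T (r *\<^sub>R x) = r *\<^sub>R T x" for r x
    using T.scale[of "complex_of_real r" x] by (simp add: scaleC_of_real)
  have "card (h ` (Y \<times> Z)) \<le> card (Y \<times> Z)" using Y(1) Z(1) by (intro card_image_le) auto
  also have "\<dots> = card Y * card Z" by (rule card_cartesian_product)
  also have "\<dots> \<le> N * N ^ k" using Y(2) Z(2) by (rule mult_le_mono)
  finally have card: "card (h ` (Y \<times> Z)) \<le> N ^ Suc k" by simp
  have "\<exists>p\<in>Y \<times> Z. (T ^^ Suc k) x \<in> cball (h p) (\<epsilon> ^ Suc k)" if x: "x \<in> cball 0 1" for x
  proof -
    obtain z where z: "z \<in> Z" "norm ((T ^^ k) x - z) \<le> \<epsilon> ^ k"
    proof -
      have "(T ^^ k) x \<in> (\<Union>z\<in>Z. cball z (\<epsilon> ^ k))" using Z(3) x by blast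
      then show thesis using that by (auto simp: dist_norm norm_minus_commute)
    qed
    define u where "u = (1 / \<epsilon> ^ k) *\<^sub>R ((T ^^ k) x - z)"
    have u: "(T ^^ k) x = z + (\<epsilon> ^ k) *\<^sub>R u" using \<open>\<epsilon> > 0\<close> by (simp add: u_def)
    have "norm u \<le> 1" using z(2) \<open>\<epsilon> > 0\<close> by (simp add: u_def divide_simps)
    then obtain y where y: "y \<in> Y" "norm (T u - y) \<le> \<epsilon>"
    proof -
      assume "norm u \<le> 1"
      then have "T u \<in> (\<Union>y\<in>Y. cball y \<epsilon>)" using Y(3) by (intro subsetD[OF Y(3)] imageI) simp
      then show thesis using that by (auto simp: dist_norm norm_minus_commute)
    qed
    have "(T ^^ Suc k) x - h (y, z) = (\<epsilon> ^ k) *\<^sub>R (T u - y)"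
      by (simp add: h_def u T.add T_R scaleR_diff_right)
    then have "norm ((T ^^ Suc k) x - h (y, z)) = \<epsilon> ^ k * norm (T u - y)"
      using \<open>\<epsilon> > 0\<close> by simp
    also have "\<dots> \<le> \<epsilon> ^ k * \<epsilon>" using y(2) \<open>\<epsilon> > 0\<close> by (intro mult_left_mono) auto
    finally have "(T ^^ Suc k) x \<in> cball (h (y, z)) (\<epsilon> ^ Suc k)"
      by (simp add: dist_norm norm_minus_commute mult.commute)
    then show ?thesis using y(1) z(1) by blast
  qed
  then have "(T ^^ Suc k) ` cball 0 1 \<subseteq> (\<Union>y\<in>h ` (Y \<times> Z). cball y (\<epsilon> ^ Suc k))"
    by (simp add: image_subset_iff Bex_def)
  then show ?case
    unfolding covered_by_def using card Y(1) Z(1) by (intro exI[of _ "h ` (Y \<times> Z)"]) auto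
qed

lemma card_separated_le_covered_by:
  assumes cov: "covered_by (f ` B) N \<epsilon>" and "S \<subseteq> B"
    and sep: "\<And>x y. x \<in> S \<Longrightarrow> y \<in> S \<Longrightarrow> x \<noteq> y \<Longrightarrow> 2 * \<epsilon> < dist (f x) (f y)"
  shows "card S \<le> N"
proof -
  obtain Y where Y: "finite Y" "card Y \<le> N" "f ` B \<subseteq> (\<Union>y\<in>Y. cball y \<epsilon>)"
    using cov unfolding covered_by_def by blast
  then have "\<forall>x\<in>S. \<exists>y\<in>Y. dist y (f x) \<le> \<epsilon>" using \<open>S \<subseteq> B\<close> by fastforce
  then obtain c where c: "\<And>x. x \<in> S \<Longrightarrow> c x \<in> Y \<and> dist (c x) (f x) \<le> \<epsilon>" by metis
  have "inj_on c S"
  proof (rule inj_onI, rule ccontr)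
    fix x y assume xy: "x \<in> S" "y \<in> S" "c x = c y" "x \<noteq> y"
    have "dist (f x) (f y) \<le> dist (c x) (f x) + dist (c y) (f y)"
      using xy(3) by (metis dist_commute dist_triangle)
    then show False using sep[OF xy(1,2,4)] c[OF xy(1)] c[OF xy(2)] by linarith
  qed
  then have "card S \<le> card Y" using c Y(1) by (intro card_inj_on_le[of c]) auto
  then show ?thesis using Y(2) by simp
qed

text \<open>The points are the combinations of \<open>e 0, \<dots>, e (n - 1)\<close> with coefficients in an \<open>M\<close> by \<open>M\<close> square
  grid of mesh \<open>g\<close> in the complex plane. If \<open>j\<close> is the highest index at which two of them differ, then
  the images under \<open>T ^^ k\<close> differ by \<open>c * l j ^ k\<close> times \<open>e j\<close> with \<open>cmod c \<ge> g\<close>, up to a vector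
  in the span of the predecessors of \<open>e j\<close>. By the normalisation of the flag that vector
  cannot cancel this term.\<close>

lemma separated_grid:
  fixes T :: "'a::complex_normed_vector \<Rightarrow> 'a"
  assumes T: "clinear T" and flag: "triangular_flag T l n e"
    and l: "\<And>j. j < n \<Longrightarrow> \<rho> \<le> cmod (l j)" and e: "\<And>j. j < n \<Longrightarrow> norm (e j) \<le> b"
    and pos: "\<rho> > 0" "g > 0" "b \<ge> 0"
  shows "\<exists>S. finite S \<and> card S = M ^ (2 * n) \<and> S \<subseteq> complex_vector.span (e ` {..<n}) \<and>
    (\<forall>x\<in>S. norm x \<le> real n * (2 * g * real M * b)) \<and>
    (\<forall>x\<in>S. \<forall>y\<in>S. x \<noteq> y \<longrightarrow> g * \<rho> ^ k \<le> norm ((T ^^ k) x - (T ^^ k) y))"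
  using flag l e
proof (induction n)
  case 0
  show ?case by (intro exI[of _ "{0}"]) auto
next
  case (Suc n)
  let ?F = "complex_vector.span (e ` {..<n})" and ?F' = "complex_vector.span (e ` {..<Suc n})"
  interpret Tk: Vector_Spaces.linear scaleC scaleC "T ^^ k" by (rule clinear_funpow[OF T])
  have flag: "triangular_flag T l n e" and tri: "T (e n) - l n *\<^sub>C e n \<in> ?F"
    and dist: "\<And>c f. f \<in> ?F \<Longrightarrow> cmod c \<le> norm (c *\<^sub>C e n + f)"
    using Suc.prems(1) by (auto simp: triangular_flag_Suc)
  obtain S where S: "finite S" "card S = M ^ (2 * n)" "S \<subseteq> ?F"
      "\<And>x. x \<in> S \<Longrightarrow> norm x \<le> real n * (2 * g * real M * b)"
      "\<And>x y. x \<in> S \<Longrightarrow> y \<in> S \<Longrightarrow> x \<noteq> y \<Longrightarrow> g * \<rho> ^ k \<le> norm ((T ^^ k) x - (T ^^ k) y)"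
    using Suc.IH[OF flag] Suc.prems(2,3) by (metis less_SucI)
  define z where "z = (\<lambda>(i::nat, j::nat). Complex (g * real i) (g * real j))"
  define h where "h = (\<lambda>(x, p). x + z p *\<^sub>C e n)"
  let ?I = "{..<M} \<times> {..<M}"
  have z_sep: "g \<le> cmod (z p - z q)" if pq: "p \<noteq> q" for p q
  proof -
    obtain i j i' j' where eq: "p = (i, j)" "q = (i', j')" by (cases p, cases q)
    have 1: "1 \<le> \<bar>real a - real b\<bar>" if "a \<noteq> b" for a b :: nat using that by linarith
    have 2: "g \<le> \<bar>g * real a - g * real b\<bar>" if "a \<noteq> b" for a b :: nat
      using mult_left_mono[OF 1[OF that], of g] pos(2)
      by (simp add: abs_mult flip: right_diff_distrib)
    have "g \<le> \<bar>Re (z p - z q)\<bar> \<or> g \<le> \<bar>Im (z p - z q)\<bar>"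
      using pq eq 2[of i i'] 2[of j j'] by (auto simp: z_def)
    then show ?thesis
      using abs_Re_le_cmod[of "z p - z q"] abs_Im_le_cmod[of "z p - z q"] by linarith
  qed
  have z_le: "cmod (z p) \<le> 2 * g * real M" if "p \<in> ?I" for p
  proof -
    have "\<bar>Re (z p)\<bar> \<le> g * real M" "\<bar>Im (z p)\<bar> \<le> g * real M"
      using that pos(2) by (auto simp: z_def abs_mult intro!: mult_left_mono)
    then show ?thesis using cmod_le[of "z p"] by simp
  qed
  have sep: "g * \<rho> ^ k \<le> norm ((T ^^ k) (h p) - (T ^^ k) (h q))"
    if pq: "p \<in> S \<times> ?I" "q \<in> S \<times> ?I" "p \<noteq> q" for p q
  proof -
    obtain x i y j where eq: "p = (x, i)" "q = (y, j)" by (cases p, cases q)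
    have xy: "x \<in> S" "y \<in> S" using pq eq by auto
    let ?c = "z i - z j"
    have diff: "(T ^^ k) (h p) - (T ^^ k) (h q)
        = (T ^^ k) (x - y) + ?c *\<^sub>C (T ^^ k) (e n)"
      by (simp add: eq h_def Tk.add Tk.diff Tk.scale complex_vector.scale_left_diff_distrib)
    show ?thesis
    proof (cases "i = j")
      case True
      then have "x \<noteq> y" using pq(3) eq by auto
      then show ?thesis using S(5)[OF xy] diff True by (simp add: Tk.diff)
    next
      case False
      have inv: "T f \<in> ?F" if "f \<in> ?F" for f
        by (rule triangular_flag_invariant[OF T flag that])
      define f where "f = (T ^^ k) (x - y) + ?c *\<^sub>C ((T ^^ k) (e n) - l n ^ k *\<^sub>C e n)"
      have "(T ^^ k) (x - y) \<in> ?F"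
        using xy S(3) by (intro funpow_in_invariant_set[OF inv] complex_vector.span_diff) auto
      moreover have "(T ^^ k) (e n) - l n ^ k *\<^sub>C e n \<in> ?F"
        using clinear_funpow_modulo_subspace[OF T complex_vector.subspace_span inv tri] by blast
      ultimately have f: "f \<in> ?F"
        unfolding f_def by (intro complex_vector.span_add complex_vector.span_scale)
      have "g * \<rho> ^ k \<le> cmod ?c * cmod (l n) ^ k"
        using z_sep[OF False] Suc.prems(2)[of n] pos by (intro mult_mono power_mono) auto
      also have "\<dots> = cmod (?c * l n ^ k)" by (simp add: norm_mult norm_power)
      also have "\<dots> \<le> norm ((?c * l n ^ k) *\<^sub>C e n + f)" by (rule dist[OF f])
      also have "(?c * l n ^ k) *\<^sub>C e n + f = (T ^^ k) (h p) - (T ^^ k) (h q)"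
        unfolding diff f_def
        by (simp add: complex_vector.scale_right_diff_distrib scaleC_scaleC)
      finally show ?thesis .
    qed
  qed
  have gp: "0 < g * \<rho> ^ k" using pos by simp
  have inj: "inj_on h (S \<times> ?I)"
  proof (rule inj_onI, rule ccontr)
    fix p q assume "p \<in> S \<times> ?I" "q \<in> S \<times> ?I" "h p = h q" "p \<noteq> q"
    then show False using sep[of p q] gp by simp
  qed
  have card: "card (h ` (S \<times> ?I)) = M ^ (2 * Suc n)"
    using card_image[OF inj] S(2) by (simp add: card_cartesian_product)
  have "h p \<in> ?F'" if "p \<in> S \<times> ?I" for p
  proof -
    have "?F \<subseteq> ?F'" by (intro complex_vector.span_mono) auto
    then have "fst p \<in> ?F'" using that S(3) by auto
    moreover have "e n \<in> ?F'" by (intro complex_vector.span_base) auto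
    ultimately show ?thesis
      unfolding h_def case_prod_beta
      by (intro complex_vector.span_add complex_vector.span_scale)
  qed
  moreover have "norm (h p) \<le> real (Suc n) * (2 * g * real M * b)" if "p \<in> S \<times> ?I" for p
  proof -
    have "norm (h p) \<le> norm (fst p) + cmod (z (snd p)) * norm (e n)"
      unfolding h_def case_prod_beta by (metis norm_triangle_ineq norm_scaleC)
    also have "\<dots> \<le> real n * (2 * g * real M * b) + 2 * g * real M * b"
      using that Suc.prems(3)[of n] pos by (intro add_mono S(4) mult_mono z_le) auto
    finally show ?thesis by (simp add: algebra_simps)
  qed
  moreover have "g * \<rho> ^ k \<le> norm ((T ^^ k) x - (T ^^ k) y)"
    if "x \<in> h ` (S \<times> ?I)" "y \<in> h ` (S \<times> ?I)" "x \<noteq> y" for x y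
    using that sep by blast
  ultimately show ?case
    using S(1) card
    by (intro exI[of _ "h ` (S \<times> ?I)"] conjI ballI impI subsetI) auto
qed

text \<open>Let \<open>q = \<rho> / \<epsilon> > 1\<close>. For a grid of mesh \<open>g = 3 / q ^ k\<close> the images are separated by
  \<open>g * \<rho> ^ k = 3 * \<epsilon> ^ k\<close>, and the grid stays in the unit ball for \<open>M\<close> proportional to \<open>q ^ k\<close>.
  Hence a constant times \<open>q ^ (2 * n * k)\<close> is at most \<open>N ^ k\<close> for all large \<open>k\<close>, which forces
  \<open>q ^ (2 * n) \<le> N\<close>. The exponent is \<open>2 * n\<close> because every complex coordinate carries a
  two-dimensional grid.\<close>

lemma power_le_of_covered_by:
  fixes T :: "'a::complex_normed_vector \<Rightarrow> 'a"
  assumes T: "clinear T" and flag: "triangular_flag T l n e" and n: "n > 0"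
    and l: "\<And>j. j < n \<Longrightarrow> \<rho> \<le> cmod (l j)" and "\<rho> \<ge> 0"
    and cov: "covered_by (T ` cball 0 1) N \<epsilon>" and "\<epsilon> > 0"
  shows "\<rho> ^ (2 * n) \<le> real N * \<epsilon> ^ (2 * n)"
proof -
  have "N > 0"
  proof (rule ccontr)
    assume "\<not> N > 0"
    then have "T ` cball 0 1 = {}" using cov unfolding covered_by_def by fastforce
    then show False by simp
  qed
  show ?thesis
  proof (cases "\<rho> \<le> \<epsilon>")
    case True
    have "\<rho> ^ (2 * n) \<le> 1 * \<epsilon> ^ (2 * n)"
      using True \<open>\<rho> \<ge> 0\<close> by (simp add: power_mono)
    also have "\<dots> \<le> real N * \<epsilon> ^ (2 * n)"
      using \<open>N > 0\<close> \<open>\<epsilon> > 0\<close> by (intro mult_right_mono) auto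
    finally show ?thesis .
  next
    case False
    define q where "q = \<rho> / \<epsilon>"
    have q: "q > 1" "\<rho> = q * \<epsilon>" using False \<open>\<epsilon> > 0\<close> by (auto simp: q_def)
    define b where "b = 1 + (\<Sum>j<n. norm (e j))"
    have "b > 0" unfolding b_def by (intro add_pos_nonneg sum_nonneg) auto
    have b: "norm (e j) \<le> b" if "j < n" for j
      using member_le_sum[of j "{..<n}" "\<lambda>j. norm (e j)"] that by (simp add: b_def)
    \<comment> \<open>Chosen so that \<open>M \<le> c * q ^ k\<close> bounds the norms of the grid points by 1.\<close>
    define c where "c = 1 / (6 * real n * b)"
    have "c > 0" using n \<open>b > 0\<close> by (simp add: c_def)
    have growth: "(c / 2) ^ (2 * n) * (q ^ (2 * n)) ^ k \<le> real N ^ k" if k: "2 \<le> c * q ^ k" for k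
    proof -
      define g where "g = 3 / q ^ k"
      define M where "M = nat \<lfloor>c * q ^ k\<rfloor>"
      have M: "real M \<le> c * q ^ k" "c / 2 * q ^ k \<le> real M"
        using k by (auto simp: M_def) linarith+
      have "g > 0" using q by (simp add: g_def)
      have "g * \<rho> ^ k = 3 * \<epsilon> ^ k" using q by (simp add: g_def power_mult_distrib)
      moreover have "\<rho> > 0" using q \<open>\<epsilon> > 0\<close> by simp
      ultimately obtain S where S: "finite S" "card S = M ^ (2 * n)"
          "\<And>x. x \<in> S \<Longrightarrow> norm x \<le> real n * (2 * g * real M * b)"
          "\<And>x y. x \<in> S \<Longrightarrow> y \<in> S \<Longrightarrow> x \<noteq> y \<Longrightarrow> 3 * \<epsilon> ^ k \<le> norm ((T ^^ k) x - (T ^^ k) y)"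
        using separated_grid[OF T flag l b _ \<open>g > 0\<close>, of M k] \<open>b > 0\<close> by auto
      have "real n * (2 * g * real M * b) \<le> real n * (2 * g * (c * q ^ k) * b)"
        using M(1) \<open>g > 0\<close> \<open>b > 0\<close> by (intro mult_left_mono mult_right_mono) auto
      also have "\<dots> = 1" using q n \<open>b > 0\<close> by (simp add: g_def c_def)
      finally have "S \<subseteq> cball 0 1" using S(3) by force
      moreover have "2 * \<epsilon> ^ k < dist ((T ^^ k) x) ((T ^^ k) y)"
        if "x \<in> S" "y \<in> S" "x \<noteq> y" for x y
        using S(4)[OF that] zero_less_power[OF \<open>\<epsilon> > 0\<close>, of k] unfolding dist_norm by linarith
      ultimately have "M ^ (2 * n) \<le> N ^ k"
        using card_separated_le_covered_by[OF covered_by_funpow[OF T cov \<open>\<epsilon> > 0\<close>, of k]] S(2)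
        by metis
      then have "real (M ^ (2 * n)) \<le> real (N ^ k)" by (simp only: of_nat_le_iff)
      moreover have "(c / 2 * q ^ k) ^ (2 * n) \<le> real M ^ (2 * n)"
        using M(2) q \<open>c > 0\<close> by (intro power_mono) auto
      moreover have "(c / 2 * q ^ k) ^ (2 * n) = (c / 2) ^ (2 * n) * (q ^ (2 * n)) ^ k"
        by (simp only: power_mult_distrib power_mult[symmetric] mult.commute)
      ultimately show ?thesis by simp
    qed
    have "q ^ (2 * n) \<le> real N"
    proof (rule ccontr)
      assume "\<not> q ^ (2 * n) \<le> real N"
      then have Q: "1 < q ^ (2 * n) / real N" using \<open>N > 0\<close> by simp
      obtain k1 where k1: "2 / c < q ^ k1" using real_arch_pow[OF q(1)] by blast
      obtain k2 where k2: "1 / (c / 2) ^ (2 * n) < (q ^ (2 * n) / real N) ^ k2"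
        using real_arch_pow[OF Q] by blast
      define k where "k = max k1 k2"
      have "q ^ k1 \<le> q ^ k" "(q ^ (2 * n) / real N) ^ k2 \<le> (q ^ (2 * n) / real N) ^ k"
        using q(1) Q by (auto simp: k_def intro!: power_increasing)
      then have k: "2 / c \<le> q ^ k" "1 / (c / 2) ^ (2 * n) < (q ^ (2 * n) / real N) ^ k"
        using k1 k2 by linarith+
      have "2 \<le> c * q ^ k" using k(1) \<open>c > 0\<close> by (simp add: field_simps)
      from growth[OF this] have "(c / 2) ^ (2 * n) * (q ^ (2 * n)) ^ k \<le> real N ^ k" .
      moreover have "real N ^ k < (c / 2) ^ (2 * n) * (q ^ (2 * n)) ^ k"
      proof -
        have "0 < (c / 2) ^ (2 * n)" "0 < real N ^ k" using \<open>c > 0\<close> \<open>N > 0\<close> by simp_all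
        then show ?thesis
          using k(2) by (simp only: power_divide[of "q ^ (2 * n)"]) (simp add: field_simps)
      qed
      ultimately show False by simp
    qed
    then have "q ^ (2 * n) * \<epsilon> ^ (2 * n) \<le> real N * \<epsilon> ^ (2 * n)"
      using \<open>\<epsilon> > 0\<close> by (intro mult_right_mono) auto
    then show ?thesis by (simp only: q(2) power_mult_distrib)
  qed
qed

section \<open>Spectral bounds by the operator norm\<close>

lemma bounded_clinear_add:
  assumes "bounded_clinear A" "bounded_clinear K"
  shows "bounded_clinear (\<lambda>x. A x + K x)"
  using assms unfolding bounded_clinear_def
  by (auto intro: bounded_linear_add simp: scaleC_add_right)

lemma norm_shifted_op_ge:
  assumes "bounded_clinear A"
  shows "(cmod l - onorm A) * norm x \<le> norm (shifted_op l A x)"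
proof -
  have "norm (A x) \<le> onorm A * norm x"
    using assms by (intro onorm) (simp add: bounded_clinear_def)
  moreover have "norm (l *\<^sub>C x) - norm (A x) \<le> norm (shifted_op l A x)"
    unfolding shifted_op_def by (rule norm_triangle_ineq2)
  ultimately show ?thesis by (simp add: norm_scaleC algebra_simps)
qed

text \<open>Surjective because \<open>l x - A x = y\<close> is the fixed point equation of a contraction, injective because
  \<open>l - A\<close> is bounded below.\<close>

lemma bij_shifted_op:
  fixes A :: "'a::complex_banach \<Rightarrow> 'a"
  assumes A: "bounded_clinear A" and l: "onorm A < cmod l"
  shows "bij (shifted_op l A)"
proof -
  interpret A: Vector_Spaces.linear scaleC scaleC A
    by (rule bounded_clinear_imp_clinear[OF A])
  have bl: "bounded_linear A" using A by (simp add: bounded_clinear_def)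
  have l0: "cmod l > 0" using l onorm_pos_le[OF bl] by linarith
  have "inj (shifted_op l A)"
  proof (rule injI)
    fix x y assume eq: "shifted_op l A x = shifted_op l A y"
    have "shifted_op l A (x - y) = shifted_op l A x - shifted_op l A y"
      by (rule clinear_diff[OF clinear_shifted_op[OF bounded_clinear_imp_clinear[OF A]]])
    then have "(cmod l - onorm A) * norm (x - y) \<le> 0"
      using norm_shifted_op_ge[OF A, of l "x - y"] eq by simp
    then show "x = y" using l by (simp add: mult_le_0_iff)
  qed
  moreover have "\<exists>x. y = shifted_op l A x" for y
  proof -
    let ?f = "\<lambda>x. (1 / l) *\<^sub>C (y + A x)"
    have "\<exists>!x. ?f x = x"
    proof (rule banach_fix_type[of "onorm A / cmod l"])
      show "0 \<le> onorm A / cmod l" using onorm_pos_le[OF bl] by simp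
      show "onorm A / cmod l < 1" using l l0 by simp
      show "\<forall>u v. dist (?f u) (?f v) \<le> onorm A / cmod l * dist u v"
      proof (intro allI)
        fix u v
        have "?f u - ?f v = (1 / l) *\<^sub>C A (u - v)"
          by (simp add: A.diff flip: complex_vector.scale_right_diff_distrib)
        then have "dist (?f u) (?f v) = norm (A (u - v)) / cmod l"
          by (simp add: dist_norm norm_scaleC norm_divide)
        also have "\<dots> \<le> onorm A * norm (u - v) / cmod l"
          using l0 by (intro divide_right_mono onorm[OF bl]) auto
        finally show "dist (?f u) (?f v) \<le> onorm A / cmod l * dist u v"
          by (simp add: dist_norm)
      qed
    qed
    then obtain x where x: "?f x = x" by auto
    have "l *\<^sub>C x = l *\<^sub>C ?f x" using x by simp
    also have "\<dots> = (l * (1 / l)) *\<^sub>C (y + A x)" by (rule scaleC_scaleC)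
    also have "\<dots> = y + A x" using l0 by simp
    finally show ?thesis unfolding shifted_op_def by (metis add_diff_cancel_right')
  qed
  ultimately show ?thesis by (simp add: bij_def surj_def)
qed

lemma spectrum_bounded:
  fixes A :: "'a::complex_banach \<Rightarrow> 'a"
  assumes A: "bounded_clinear A" and "l \<in> spectrum A"
  shows "cmod l \<le> onorm A"
proof (rule ccontr)
  assume "\<not> cmod l \<le> onorm A"
  then have l: "onorm A < cmod l" by simp
  let ?L = "shifted_op l A"
  note bij = bij_shifted_op[OF A l]
  interpret L: Vector_Spaces.linear scaleC scaleC ?L
    by (rule clinear_shifted_op[OF bounded_clinear_imp_clinear[OF A]])
  have L: "?L (inv ?L y) = y" for y using bij by (simp add: bij_def surj_f_inv_f)
  have inv: "inv ?L (?L x) = x" for x using bij by (simp add: bij_def)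
  have add: "inv ?L (x + y) = inv ?L x + inv ?L y" for x y
    using inv[of "inv ?L x + inv ?L y"] by (simp add: L.add L)
  have scale: "inv ?L (c *\<^sub>C x) = c *\<^sub>C inv ?L x" for c x
    using inv[of "c *\<^sub>C inv ?L x"] by (simp add: L.scale L)
  have "bounded_linear (inv ?L)"
  proof (rule bounded_linear_intro[where K = "1 / (cmod l - onorm A)"])
    show "inv ?L (x + y) = inv ?L x + inv ?L y" for x y by (rule add)
    show "inv ?L (r *\<^sub>R x) = r *\<^sub>R inv ?L x" for r x
      using scale[of "complex_of_real r" x] by (simp add: scaleC_of_real)
    show "norm (inv ?L x) \<le> norm x * (1 / (cmod l - onorm A))" for x
      using norm_shifted_op_ge[OF A, of l "inv ?L x"] l by (simp add: L field_simps)
  qed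
  then have "bounded_clinear (inv ?L)" using scale by (simp add: bounded_clinear_def)
  then have "boundedly_invertible ?L"
    unfolding boundedly_invertible_def using L inv
    by (intro exI[of _ "inv ?L"]) (auto simp: fun_eq_iff)
  then show False using assms(2) by (simp add: spectrum_def)
qed

lemma eigenvalue_le_spectral_radius:
  fixes T :: "'a::complex_banach \<Rightarrow> 'a"
  assumes T: "bounded_clinear T" and "eigenvalue T l"
  shows "cmod l \<le> spectral_radius T"
  unfolding spectral_radius_def
proof (rule cSUP_upper)
  obtain x where x: "x \<noteq> 0" "T x = l *\<^sub>C x" using assms(2) by (auto simp: eigenvalue_def)
  show "l \<in> spectrum T"
    unfolding spectrum_def mem_Collect_eq boundedly_invertible_def
  proof (intro notI, elim exE conjE)
    fix S assume S: "bounded_clinear S" "S \<circ> shifted_op l T = id"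
    have "x = S (shifted_op l T x)" using S(2) by (metis comp_apply id_apply)
    also have "\<dots> = 0"
      using x(2) clinear_diff[OF bounded_clinear_imp_clinear[OF S(1)], of 0 0]
      by (simp add: shifted_op_def)
    finally show False using x(1) by simp
  qed
  show "bdd_above (cmod ` spectrum T)"
    using spectrum_bounded[OF T] by (auto intro!: bdd_aboveI)
qed

text \<open>Outside the disk of radius \<open>\<parallel>A\<parallel>\<close> the operator \<open>l - A\<close> is bijective and therefore Fredholm.\<close>

lemma essential_spectral_radius_bounds:
  fixes A :: "'a::complex_banach \<Rightarrow> 'a"
  assumes A: "bounded_clinear A"
  shows "0 \<le> essential_spectral_radius A" "essential_spectral_radius A \<le> onorm A"
proof -
  have le: "cmod l \<le> onorm A" if "l \<in> essential_spectrum A" for l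
  proof (rule ccontr)
    assume "\<not> cmod l \<le> onorm A"
    then have bij: "bij (shifted_op l A)" by (intro bij_shifted_op[OF A]) simp
    have "shifted_op l A 0 = 0"
      using clinear_diff[OF clinear_shifted_op[OF bounded_clinear_imp_clinear[OF A]], of l 0 0]
      by simp
    then have "{x. shifted_op l A x = 0} = {0}"
      using bij by (auto simp: bij_def) (metis injD)
    moreover have "range (shifted_op l A) = UNIV" using bij by (simp add: bij_def)
    ultimately have "fredholm (shifted_op l A)"
      unfolding fredholm_def finite_dimensional_def finite_codimensional_def
      by (auto intro!: exI[of _ "{}"])
    then show False using that by (simp add: essential_spectrum_def)
  qed
  have "0 \<le> onorm A" using A by (intro onorm_pos_le) (simp add: bounded_clinear_def)
  then show "essential_spectral_radius A \<le> onorm A"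
    unfolding essential_spectral_radius_def using le by (auto intro: cSUP_least)
  have "0 \<le> (SUP l\<in>essential_spectrum A. cmod l)" if ne: "essential_spectrum A \<noteq> {}"
  proof -
    obtain l where "l \<in> essential_spectrum A" using ne by blast
    moreover have "bdd_above (cmod ` essential_spectrum A)"
      using le by (auto intro!: bdd_aboveI)
    ultimately show ?thesis by (intro cSUP_upper2[of cmod _ l]) auto
  qed
  then show "0 \<le> essential_spectral_radius A"
    unfolding essential_spectral_radius_def by simp
qed

section \<open>Entropy numbers\<close>

lemma entropy_number_eq_Inf_covered_by:
  "entropy_number m K = Inf {\<epsilon>. 0 < \<epsilon> \<and> covered_by (K ` cball 0 1) (2 ^ (m - 1)) \<epsilon>}"
  unfolding entropy_number_def covered_by_def ..

lemma covered_by_mono: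
  assumes "covered_by S N \<epsilon>" and "\<epsilon> \<le> \<delta>"
  shows "covered_by S N \<delta>"
proof -
  obtain Y where Y: "finite Y" "card Y \<le> N" "S \<subseteq> (\<Union>y\<in>Y. cball y \<epsilon>)"
    using assms(1) unfolding covered_by_def by blast
  have "S \<subseteq> (\<Union>y\<in>Y. cball y \<delta>)"
    using Y(3) by (rule order_trans) (intro UN_mono order_refl subset_cball assms(2))
  then show ?thesis using Y unfolding covered_by_def by blast
qed

lemma covered_by_entropy_number:
  assumes K: "bounded_clinear K" and less: "entropy_number m K < \<epsilon>"
  shows "covered_by (K ` cball 0 1) (2 ^ (m - 1)) \<epsilon>"
proof -
  let ?E = "{\<epsilon>. 0 < \<epsilon> \<and> covered_by (K ` cball 0 1) (2 ^ (m - 1)) \<epsilon>}"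
  have bl: "bounded_linear K" using K by (simp add: bounded_clinear_def)
  have "norm (K x) \<le> onorm K + 1" if "norm x \<le> 1" for x
    using onorm[OF bl, of x] mult_left_mono[OF that onorm_pos_le[OF bl]] by simp
  then have "K ` cball 0 1 \<subseteq> cball 0 (onorm K + 1)" by auto
  then have "covered_by (K ` cball 0 1) (2 ^ (m - 1)) (onorm K + 1)"
    unfolding covered_by_def by (intro exI[of _ "{0}"]) simp
  then have "onorm K + 1 \<in> ?E"
    using onorm_pos_le[OF bl] by simp
  moreover have "Inf ?E < \<epsilon>" using less by (simp only: entropy_number_eq_Inf_covered_by)
  ultimately obtain \<delta> where "\<delta> \<in> ?E" "\<delta> < \<epsilon>"
    using cInf_lessD[of ?E \<epsilon>] by (metis empty_iff)
  then show ?thesis by (auto intro: covered_by_mono)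
qed

lemma entropy_number_nonneg: "0 \<le> entropy_number m (K :: 'a::complex_normed_vector \<Rightarrow> 'a)"
  if "bounded_clinear K"
proof (rule ccontr)
  assume "\<not> 0 \<le> entropy_number m K"
  then have "covered_by (K ` cball 0 1) (2 ^ (m - 1)) (entropy_number m K / 2)"
    by (intro covered_by_entropy_number[OF that]) simp
  moreover have "cball y (entropy_number m K / 2) = {}" for y :: 'a
    using \<open>\<not> 0 \<le> entropy_number m K\<close> by (intro cball_empty) simp
  ultimately have "K ` cball 0 1 = {}" by (simp add: covered_by_def)
  then show False by simp
qed

lemma covered_by_perturbation:
  assumes A: "bounded_linear A" and cov: "covered_by (K ` cball 0 1) N \<epsilon>"
  shows "covered_by ((\<lambda>x. A x + K x) ` cball 0 1) N (onorm A + \<epsilon>)"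
proof -
  obtain Y where Y: "finite Y" "card Y \<le> N" "K ` cball 0 1 \<subseteq> (\<Union>y\<in>Y. cball y \<epsilon>)"
    using cov unfolding covered_by_def by blast
  have "A x + K x \<in> (\<Union>y\<in>Y. cball y (onorm A + \<epsilon>))" if x: "x \<in> cball 0 1" for x
  proof -
    have "K x \<in> (\<Union>y\<in>Y. cball y \<epsilon>)" using Y(3) x by blast
    then obtain y where y: "y \<in> Y" "norm (K x - y) \<le> \<epsilon>"
      by (auto simp: dist_norm norm_minus_commute)
    have "norm (A x) \<le> onorm A * norm x" by (rule onorm[OF A])
    also have "\<dots> \<le> onorm A * 1" using x by (intro mult_left_mono onorm_pos_le[OF A]) simp
    finally have "norm (A x + (K x - y)) \<le> onorm A + \<epsilon>"
      using y(2) norm_triangle_ineq[of "A x" "K x - y"] by simp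
    then have "A x + K x \<in> cball y (onorm A + \<epsilon>)"
      by (simp add: dist_norm norm_minus_commute add_diff_eq)
    then show ?thesis using y(1) by blast
  qed
  then have "(\<lambda>x. A x + K x) ` cball 0 1 \<subseteq> (\<Union>y\<in>Y. cball y (onorm A + \<epsilon>))" by blast
  then show ?thesis using Y(1,2) unfolding covered_by_def by blast
qed

text \<open>The inequality \<open>\<rho> \<le> 2 powr ((m - 1) / (2 n)) * (\<parallel>A\<parallel> + e\<^sub>m(K))\<close>, linearised in the exponent by
  \<open>2 powr (- x) \<ge> 1 - x ln 2\<close>, which separates the contribution of \<open>m\<close> from that of \<open>\<parallel>A\<parallel>\<close>.\<close>

lemma triangular_flag_modulus_le:
  fixes A K :: "'a::complex_normed_vector \<Rightarrow> 'a"
  assumes A: "bounded_clinear A" and K: "bounded_clinear K"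
    and flag: "triangular_flag (\<lambda>x. A x + K x) l n e" and n: "n > 0"
    and l: "\<And>j. j < n \<Longrightarrow> \<rho> \<le> cmod (l j)" and "\<rho> \<ge> 0" and "m \<ge> 1"
  shows "\<rho> * (1 - ln 2 * (real m - 1) / (2 * real n)) - onorm A \<le> entropy_number m K"
proof (rule dense_ge)
  fix \<epsilon> assume \<epsilon>: "entropy_number m K < \<epsilon>"
  let ?a = "onorm A" and ?x = "(real m - 1) / (2 * real n)"
  have blA: "bounded_linear A" using A by (simp add: bounded_clinear_def)
  have pos: "?a + \<epsilon> > 0"
    using \<epsilon> entropy_number_nonneg[OF K, of m] onorm_pos_le[OF blA] by linarith
  have "\<rho> ^ (2 * n) \<le> real (2 ^ (m - 1)) * (?a + \<epsilon>) ^ (2 * n)"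
    by (rule power_le_of_covered_by[OF bounded_clinear_imp_clinear[OF bounded_clinear_add[OF A K]]
          flag n l \<open>\<rho> \<ge> 0\<close> covered_by_perturbation[OF blA covered_by_entropy_number[OF K \<epsilon>]] pos])
  also have "real (2 ^ (m - 1)) = (2 powr ?x) ^ (2 * n)"
    using n \<open>m \<ge> 1\<close>
    by (simp only: powr_realpow[symmetric] powr_powr of_nat_power)
       (simp add: powr_powr powr_realpow[symmetric] of_nat_diff)
  finally have "\<rho> ^ (2 * n) \<le> (2 powr ?x * (?a + \<epsilon>)) ^ (2 * n)"
    by (simp only: power_mult_distrib)
  then have "\<rho> \<le> 2 powr ?x * (?a + \<epsilon>)"
    using pos n by (subst (asm) power_mono_iff) (use \<open>\<rho> \<ge> 0\<close> in auto)
  then have "\<rho> * 2 powr (- ?x) \<le> ?a + \<epsilon>"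
    by (simp add: powr_minus field_simps)
  moreover have "1 - ln 2 * ?x \<le> 2 powr (- ?x)"
    using exp_ge_add_one_self[of "- ?x * ln 2"] by (simp add: powr_def mult.commute)
  then have "\<rho> * (1 - ln 2 * ?x) \<le> \<rho> * 2 powr (- ?x)"
    using \<open>\<rho> \<ge> 0\<close> by (rule mult_left_mono)
  ultimately show "\<rho> * (1 - ln 2 * (real m - 1) / (2 * real n)) - ?a \<le> \<epsilon>"
    by simp
qed

lemma entropy_number_le_quasinorm:
  assumes K: "K \<in> entropy_class p" and "m \<ge> 1"
  shows "real m powr (1 / p) * entropy_number m K \<le> enn2real (entropy_quasinorm p K)"
proof -
  have "ennreal (real m powr (1 / p) * entropy_number m K) \<le> entropy_quasinorm p K"
    unfolding entropy_quasinorm_def using \<open>m \<ge> 1\<close> by (intro SUP_upper) auto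
  also have "\<dots> = ennreal (enn2real (entropy_quasinorm p K))"
    using K by (simp add: entropy_class_def)
  finally show ?thesis by (simp add: ennreal_le_iff)
qed

text \<open>The right-hand side of the bound is minimal at \<open>s = (\<kappa> / (p a)) powr (p / (p + 1))\<close>; there the second
  summand is \<open>p\<close> times the first, and the sum is \<open>(p + 1) a s\<close>.\<close>

lemma optimise_sum_of_powers:
  fixes t a \<kappa> p :: real
  assumes pos: "t > 0" "a > 0" "\<kappa> \<ge> 0" "p > 0"
    and bound: "\<And>s. s > 0 \<Longrightarrow> t \<le> a * s + \<kappa> * s powr (- (1 / p))"
  shows "t powr (p + 1) \<le> (p + 1) powr (p + 1) * a * \<kappa> powr p / p powr p"
proof (cases "\<kappa> = 0")
  case True
  \<comment> \<open>Then the hypothesis is contradictory: letting \<open>s\<close> tend to 0 gives \<open>t \<le> 0\<close>.\<close>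
  then show ?thesis using bound[of "t / (2 * a)"] pos by simp
next
  case False
  define v where "v = \<kappa> / (p * a)"
  define s where "s = v powr (p / (p + 1))"
  have "v > 0" using False pos by (simp add: v_def)
  have "s > 0" using \<open>v > 0\<close> by (simp add: s_def)
  have "\<kappa> * s powr (- (1 / p)) = p * a * (v powr 1 * v powr (- (1 / (p + 1))))"
    using pos \<open>v > 0\<close> unfolding s_def powr_powr by (simp add: v_def)
  also have "v powr 1 * v powr (- (1 / (p + 1))) = s"
  proof -
    have "1 + - (1 / (p + 1)) = p / (p + 1)" using pos by (simp add: field_simps)
    then show ?thesis unfolding s_def by (simp only: powr_add[symmetric])
  qed
  finally have "t \<le> (p + 1) * a * s" using bound[OF \<open>s > 0\<close>] by (simp add: algebra_simps)
  then have "t powr (p + 1) \<le> ((p + 1) * a * s) powr (p + 1)"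
    using pos by (intro powr_mono2) auto
  also have "\<dots> = (p + 1) powr (p + 1) * a powr (p + 1) * s powr (p + 1)"
    using pos \<open>s > 0\<close> by (simp add: powr_mult)
  also have "s powr (p + 1) = v powr p" using pos by (simp add: s_def powr_powr)
  also have "v powr p = \<kappa> powr p / (p powr p * a powr p)"
    using pos by (simp add: v_def powr_divide powr_mult)
  also have "a powr (p + 1) = a powr p * a" using pos by (simp add: powr_add)
  finally show ?thesis using pos by simp
qed

section \<open>The weak quasi-norm of the eigenvalue sequence\<close>

text \<open>Finite dimension excludes the default value 0 of \<^const>\<open>vector_space.dim\<close>. Since \<^const>\<open>card\<close> is 0
  on infinite sets, positivity shows that a discrete eigenvalue occupies only finitely many
  places of an eigenvalue sequence.\<close>

lemma algebraic_multiplicity_pos: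
  assumes "l \<in> discrete_eigenvalues T"
  shows "algebraic_multiplicity T l > 0"
proof -
  let ?G = "generalized_eigenspace T l"
  obtain x where x: "x \<noteq> 0" "T x = l *\<^sub>C x"
    using assms by (auto simp: discrete_eigenvalues_def eigenvalue_def)
  then have "(shifted_op l T ^^ 1) x = 0" by (simp add: shifted_op_def)
  then have "x \<in> ?G" unfolding generalized_eigenspace_def by blast
  obtain C where C: "finite C" "?G \<subseteq> complex_vector.span C"
    using assms by (auto simp: discrete_eigenvalues_def finite_dimensional_def)
  obtain B where B: "B \<subseteq> ?G" "complex_vector.independent B" "?G \<subseteq> complex_vector.span B"
      "card B = complex_vector.dim ?G"
    by (rule complex_vector.basis_exists)
  have "finite B" using complex_vector.independent_span_bound[OF C(1) B(2)] B(1) C(2) by blast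
  moreover have "B \<noteq> {}" using B(3) \<open>x \<in> ?G\<close> x(1) by auto
  ultimately show ?thesis unfolding algebraic_multiplicity_def using B(4) by (metis card_gt_0_iff)
qed

text \<open>The value \<open>x n\<close> is itself an admissible threshold: for a decreasing sequence, only indices below \<open>n\<close>
  can carry larger values.\<close>

lemma decreasing_rearrangement_le:
  assumes "\<And>n. 0 \<le> x n" and "\<And>m n. 1 \<le> m \<Longrightarrow> m \<le> n \<Longrightarrow> x n \<le> x m" and "n \<ge> 1"
  shows "decreasing_rearrangement x n \<le> ennreal (x n)"
proof -
  have sub: "{k. 1 \<le> k \<and> x n < \<bar>x k\<bar>} \<subseteq> {1..<n}"
    using assms by (auto simp: not_le[symmetric])
  then have "finite {k. 1 \<le> k \<and> x n < \<bar>x k\<bar>}" by (rule finite_subset) simp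
  moreover have "card {k. 1 \<le> k \<and> x n < \<bar>x k\<bar>} < n"
    using card_mono[OF _ sub] \<open>n \<ge> 1\<close> by simp
  ultimately show ?thesis
    unfolding decreasing_rearrangement_def using assms(1) by (intro INF_lower) auto
qed

text \<open>The inequality of the theorem for a single index. The first \<open>n\<close> entries of the sequence have modulus above
  \<open>\<parallel>A\<parallel>\<close>, so they are eigenvalues rather than padding, and each occurs no more often than its
  multiplicity; they are therefore the diagonal of a flag.\<close>

lemma excess_power_le:
  fixes A K :: "'a::complex_banach \<Rightarrow> 'a"
  assumes A: "bounded_clinear A" and "p > 0" and K: "K \<in> entropy_class p"
    and ev: "eigenvalue_sequence (\<lambda>x. A x + K x) (essential_spectral_radius A) ev"
    and n: "n \<ge> 1" and t: "onorm A < cmod (ev n)"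
  shows "real n * (cmod (ev n) - onorm A) powr (p + 1)
    \<le> entropy_const p * spectral_radius (\<lambda>x. A x + K x) * enn2real (entropy_quasinorm p K) powr p"
proof -
  let ?T = "\<lambda>x. A x + K x" and ?r = "spectral_radius (\<lambda>x. A x + K x)"
  let ?\<rho> = "essential_spectral_radius A" and ?\<kappa> = "enn2real (entropy_quasinorm p K)"
  have blK: "bounded_clinear K" using K by (simp add: entropy_class_def)
  note T = bounded_clinear_add[OF A blK]
  have A0: "0 \<le> onorm A" using A by (intro onorm_pos_le) (simp add: bounded_clinear_def)
  have dec: "cmod (ev n) \<le> cmod (ev i)" if "1 \<le> i" "i \<le> n" for i
    using ev that by (auto simp: eigenvalue_sequence_def)
  have outside: "ev i \<in> discrete_eigenvalues_outside ?T ?\<rho>" if i: "1 \<le> i" "i \<le> n" for i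
  proof -
    have "ev i \<noteq> complex_of_real ?\<rho>"
      using dec[OF i] t essential_spectral_radius_bounds[OF A] by auto
    then show ?thesis using ev i by (auto simp: eigenvalue_sequence_def)
  qed
  have mult: "card {j. j < n \<and> ev (Suc j) = ev (Suc i)} \<le> algebraic_multiplicity ?T (ev (Suc i))"
    if "i < n" for i
  proof -
    let ?I = "{k. 1 \<le> k \<and> ev k = ev (Suc i)}"
    have out: "ev (Suc i) \<in> discrete_eigenvalues_outside ?T ?\<rho>" using outside that by simp
    then have card: "card ?I = algebraic_multiplicity ?T (ev (Suc i))"
      using ev unfolding eigenvalue_sequence_def by blast
    moreover have "algebraic_multiplicity ?T (ev (Suc i)) > 0"
      using out by (intro algebraic_multiplicity_pos) (simp add: discrete_eigenvalues_outside_def)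
    ultimately have "finite ?I" by (metis card_gt_0_iff)
    then have "card {j. j < n \<and> ev (Suc j) = ev (Suc i)} \<le> card ?I"
      by (intro card_inj_on_le[of Suc]) auto
    then show ?thesis using card by simp
  qed
  obtain e where flag: "triangular_flag ?T (\<lambda>j. ev (Suc j)) n e"
    using triangular_flag_exists[OF bounded_clinear_imp_clinear[OF T], of n "\<lambda>j. ev (Suc j)"] mult
    by auto
  have r: "cmod (ev n) \<le> ?r"
    using outside[OF n order_refl]
    by (intro eigenvalue_le_spectral_radius[OF T])
       (simp add: discrete_eigenvalues_outside_def discrete_eigenvalues_def)
  have "?r > 0" using r t A0 by linarith
  define a where "a = ?r * ln 2 / (2 * real n)"
  have "a > 0" using \<open>?r > 0\<close> n by (simp add: a_def)
  define t where "t = cmod (ev n) - onorm A"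
  have "t \<le> a * s + ?\<kappa> * s powr (- (1 / p))" if "s > 0" for s
  proof -
    \<comment> \<open>The ceiling serves both occurrences of \<open>m\<close>: \<open>m - 1 \<le> s\<close> in the increasing term and
      \<open>s \<le> m\<close> in the decreasing one.\<close>
    define m where "m = nat \<lceil>s\<rceil>"
    have m: "m \<ge> 1" "real m - 1 \<le> s" "s \<le> real m"
      using \<open>s > 0\<close> by (auto simp: m_def) linarith+
    have "t - cmod (ev n) * (ln 2 * (real m - 1) / (2 * real n)) \<le> entropy_number m K"
      using triangular_flag_modulus_le[OF A blK flag _ _ _ m(1), of "cmod (ev n)"] dec n
      by (simp add: t_def algebra_simps)
    moreover have "cmod (ev n) * (ln 2 * (real m - 1) / (2 * real n))
        \<le> ?r * (ln 2 * s / (2 * real n))"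
      using r m \<open>?r > 0\<close> by (intro mult_mono divide_right_mono mult_left_mono) auto
    moreover have "?r * (ln 2 * s / (2 * real n)) = a * s" by (simp add: a_def)
    moreover have "entropy_number m K \<le> ?\<kappa> * real m powr (- (1 / p))"
      using entropy_number_le_quasinorm[OF K m(1)] m(1)
      by (simp add: powr_minus field_simps)
    moreover have "?\<kappa> * real m powr (- (1 / p)) \<le> ?\<kappa> * s powr (- (1 / p))"
      using m \<open>s > 0\<close> \<open>p > 0\<close> by (intro mult_left_mono powr_mono2') auto
    ultimately show ?thesis by linarith
  qed
  then have "t powr (p + 1) \<le> (p + 1) powr (p + 1) * a * ?\<kappa> powr p / p powr p"
    using \<open>a > 0\<close> \<open>p > 0\<close> assms(6) by (intro optimise_sum_of_powers) (auto simp: t_def)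
  then have "real n * t powr (p + 1) \<le> real n * ((p + 1) powr (p + 1) * a * ?\<kappa> powr p / p powr p)"
    by (intro mult_left_mono) auto
  also have "\<dots> = entropy_const p * ?r * ?\<kappa> powr p"
    using n by (simp add: a_def entropy_const_def)
  finally show ?thesis by (simp only: t_def)
qed

theorem corollary1:
  fixes A K :: "'a::complex_banach \<Rightarrow> 'a" and p :: real and ev :: "nat \<Rightarrow> complex"
  assumes "bounded_clinear A" and "A \<noteq> (\<lambda>x. 0)"
    and "p > 0" and "K \<in> entropy_class p"
    and "eigenvalue_sequence (\<lambda>x. A x + K x) (essential_spectral_radius A) ev"
  shows "weak_lq_norm (p + 1) (\<lambda>n. max (cmod (ev n) - onorm A) 0) powr\<^sub>e (p + 1)
    \<le> ennreal (entropy_const p * spectral_radius (\<lambda>x. A x + K x)) * entropy_quasinorm p K powr\<^sub>e p"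
proof -
  define x where "x = (\<lambda>n. max (cmod (ev n) - onorm A) 0)"
  define \<kappa> where "\<kappa> = enn2real (entropy_quasinorm p K)"
  define C where "C = entropy_const p * spectral_radius (\<lambda>x. A x + K x)"
  \<comment> \<open>On the zero space the spectrum is empty and its supremum, hence \<open>C\<close>, has no
    definite sign; the cut-off agrees with the one of \<^const>\<open>ennreal\<close>.\<close>
  define R where "R = max 0 C * \<kappa> powr p"
  have "R \<ge> 0" by (simp add: R_def)
  have dec: "x n \<le> x m" if "1 \<le> m" "m \<le> n" for m n
  proof -
    have "cmod (ev n) \<le> cmod (ev m)"
      using assms(5) that by (auto simp: eigenvalue_sequence_def)
    then show ?thesis by (simp add: x_def max.coboundedI1)
  qed
  have term_le: "real n powr (1 / (p + 1)) * x n \<le> R powr (1 / (p + 1))" if "n \<ge> 1" for n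
  proof (cases "onorm A < cmod (ev n)")
    case True
    have x: "x n = cmod (ev n) - onorm A" "x n > 0" using True by (auto simp: x_def)
    have "real n * x n powr (p + 1) \<le> C * \<kappa> powr p"
      using excess_power_le[OF assms(1,3,4,5) that True] by (simp add: x(1) C_def \<kappa>_def)
    also have "\<dots> \<le> R" unfolding R_def by (intro mult_right_mono) auto
    finally have "(real n * x n powr (p + 1)) powr (1 / (p + 1)) \<le> R powr (1 / (p + 1))"
      using \<open>p > 0\<close> by (intro powr_mono2) auto
    moreover have "(real n * x n powr (p + 1)) powr (1 / (p + 1)) = real n powr (1 / (p + 1)) * x n"
      using \<open>p > 0\<close> x(2) by (simp add: powr_mult powr_powr)
    ultimately show ?thesis by simp
  next
    case False
    then have "x n = 0" by (simp add: x_def)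
    then show ?thesis by simp
  qed
  have weak: "weak_lq_norm (p + 1) x \<le> ennreal (R powr (1 / (p + 1)))"
    unfolding weak_lq_norm_def
  proof (rule SUP_least)
    fix n :: nat assume "n \<in> {1..}"
    then have n: "n \<ge> 1" by simp
    have "ennreal (real n powr (1 / (p + 1))) * decreasing_rearrangement x n
        \<le> ennreal (real n powr (1 / (p + 1))) * ennreal (x n)"
      using dec n by (intro mult_left_mono decreasing_rearrangement_le) (auto simp: x_def)
    also have "\<dots> = ennreal (real n powr (1 / (p + 1)) * x n)"
      by (rule ennreal_mult'[symmetric]) simp
    also have "\<dots> \<le> ennreal (R powr (1 / (p + 1)))" by (intro ennreal_leI term_le n)
    finally show "ennreal (real n powr (1 / (p + 1))) * decreasing_rearrangement x n
        \<le> ennreal (R powr (1 / (p + 1)))" .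
  qed
  have "weak_lq_norm (p + 1) x \<noteq> top" using weak by (auto simp: top_unique)
  moreover have "enn2real (weak_lq_norm (p + 1) x) \<le> R powr (1 / (p + 1))"
    using enn2real_mono[OF weak] by simp
  then have "enn2real (weak_lq_norm (p + 1) x) powr (p + 1) \<le> (R powr (1 / (p + 1))) powr (p + 1)"
    using \<open>p > 0\<close> by (intro powr_mono2) auto
  then have "enn2real (weak_lq_norm (p + 1) x) powr (p + 1) \<le> R"
    using \<open>p > 0\<close> \<open>R \<ge> 0\<close> by (simp add: powr_powr)
  ultimately have "weak_lq_norm (p + 1) x powr\<^sub>e (p + 1) \<le> ennreal R"
    by (simp add: ennreal_powr_def ennreal_leI)
  also have "ennreal R = ennreal (max 0 C) * ennreal (\<kappa> powr p)"
    unfolding R_def by (rule ennreal_mult) auto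
  also have "ennreal (max 0 C) = ennreal C" by (cases "C \<ge> 0") (auto simp: ennreal_neg)
  also have "ennreal (\<kappa> powr p) = entropy_quasinorm p K powr\<^sub>e p"
    using assms(4) by (auto simp: ennreal_powr_def \<kappa>_def entropy_class_def)
  finally show ?thesis by (simp only: x_def C_def)
qed

end
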